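(* Let $S$ be a commutative ring, let $l\in S$ be a regular element, and let $R=S/(l)$. Let $G_0,G_1,G_2$ and $F_0,F_1,F_2$ be $S$-modules with $S$-linear maps $g_2:G_2\to G_1$, $g_1:G_1\to G_0$, $f_2:F_2\to F_1$, $f_1:F_1\to F_0$, and $p_i:G_i\to F_i$ for $i=0,1,2$, such that: (i) for each $i=0,1,2$ the sequence $0\to G_i\xrightarrow{\ \cdot l\ }G_i\xrightarrow{\ p_i\ }F_i\to 0$ is exact; (ii) $p_1\circ g_2=f_2\circ p_2$ and $p_0\circ g_1=f_1\circ p_1$; (iii) the sequence $F_2\xrightarrow{f_2}F_1\xrightarrow{f_1}F_0$ is exact (at $F_1$). (It is not assumed that $g_1\circ g_2=0$.) Then $\operatorname{coker}(g_1)$ is a lifting (via $l$) of $\operatorname{coker}(f_1)$ if and only if $(g_1\circ g_2)(G_2)\subseteq l\cdot g_1(G_1)$.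
   Context: Given an $R$-module $M$ and an $S$-module $N$, where $R=S/(l)$, $N$ is called a lifting of $M$ (via $l$) if $l$ is regular on $N$ (i.e. multiplication by $l$ on $N$ is injective) and $N/lN\cong M$. Note that each $F_i\cong G_i/lG_i$ is annihilated by $l$, hence is an $R$-module. *)

theory Defs
  imports "HOL-Algebra.Module" "HOL-Algebra.QuotRing"
begin

definition regular_element :: "('a, 'm) ring_scheme \<Rightarrow> 'a \<Rightarrow> bool" where
  "regular_element S l \<longleftrightarrow> l \<in> carrier S \<and> inj_on (\<lambda>a. l \<otimes>\<^bsub>S\<^esub> a) (carrier S)"

definition regular_on :: "'a \<Rightarrow> ('a, 'b, 'n) module_scheme \<Rightarrow> bool" where
  "regular_on l N \<longleftrightarrow> inj_on (\<lambda>x. l \<odot>\<^bsub>N\<^esub> x) (carrier N)"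

definition module_homs ::
    "('a, 'm) ring_scheme \<Rightarrow> ('a, 'b, 'n) module_scheme \<Rightarrow> ('a, 'c, 'k) module_scheme \<Rightarrow> ('b \<Rightarrow> 'c) set" where
  "module_homs R M N = {f \<in> hom (add_monoid M) (add_monoid N).
     \<forall>a\<in>carrier R. \<forall>x\<in>carrier M. f (a \<odot>\<^bsub>M\<^esub> x) = a \<odot>\<^bsub>N\<^esub> f x}"

definition module_isomorphic ::
    "('a, 'm) ring_scheme \<Rightarrow> ('a, 'b, 'n) module_scheme \<Rightarrow> ('a, 'c, 'k) module_scheme \<Rightarrow> bool" where
  "module_isomorphic R M N \<longleftrightarrow> (\<exists>f\<in>module_homs R M N. bij_betw f (carrier M) (carrier N))"

definition exact_at ::
    "('a, 'm) ring_scheme \<Rightarrow> ('a, 'b, 'n) module_scheme \<Rightarrow> ('b \<Rightarrow> 'c) \<Rightarrow> ('a, 'c, 'k) module_scheme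
      \<Rightarrow> ('c \<Rightarrow> 'd) \<Rightarrow> ('a, 'd, 'j) module_scheme \<Rightarrow> bool" where
  "exact_at R M f N g P \<longleftrightarrow>
     f \<in> module_homs R M N \<and> g \<in> module_homs R N P \<and> f ` carrier M = a_kernel N P g"

definition short_exact ::
    "('a, 'm) ring_scheme \<Rightarrow> ('a, 'b, 'n) module_scheme \<Rightarrow> ('b \<Rightarrow> 'c) \<Rightarrow> ('a, 'c, 'k) module_scheme
      \<Rightarrow> ('c \<Rightarrow> 'd) \<Rightarrow> ('a, 'd, 'j) module_scheme \<Rightarrow> bool" where
  "short_exact R M f N g P \<longleftrightarrow>
     inj_on f (carrier M) \<and> exact_at R M f N g P \<and> g ` carrier N = carrier P"

text \<open>
  The fields \<open>mult\<close> and \<open>one\<close> that a module record inherits from \<open>ring\<close> play no role in the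
  locale \<open>module\<close>; they are left undefined below. Scalar multiplication on cosets follows the
  pattern of \<open>rcoset_mult\<close>.
\<close>

definition quot_module :: "('a, 'b, 'n) module_scheme \<Rightarrow> 'b set \<Rightarrow> ('a, 'b set) module" where
  "quot_module M H =
     \<lparr>carrier = a_rcosets\<^bsub>M\<^esub> H, mult = undefined, one = undefined,
      zero = H, add = set_add M,
      smult = (\<lambda>a X. \<Union>x\<in>X. H +>\<^bsub>M\<^esub> (a \<odot>\<^bsub>M\<^esub> x))\<rparr>"

definition coker ::
    "('a, 'b, 'n) module_scheme \<Rightarrow> ('b \<Rightarrow> 'c) \<Rightarrow> ('a, 'c, 'k) module_scheme \<Rightarrow> ('a, 'c set) module" where
  "coker M f N = quot_module N (f ` carrier M)"

text \<open>
  An \<open>S\<close>-module \<open>M\<close> annihilated by an ideal \<open>I\<close>, regarded as a module over \<open>S Quot I\<close>: a coset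
  acts through any of its representatives, so \<open>{a \<odot> x | a \<in> A}\<close> is a singleton. Meaningful only
  if \<open>I\<close> annihilates \<open>M\<close>.
\<close>

definition as_Quot_module :: "('a, 'b, 'n) module_scheme \<Rightarrow> ('a set, 'b) module" where
  "as_Quot_module M =
     \<lparr>carrier = carrier M, mult = undefined, one = undefined,
      zero = \<zero>\<^bsub>M\<^esub>, add = add M,
      smult = (\<lambda>A x. the_elem ((\<lambda>a. a \<odot>\<^bsub>M\<^esub> x) ` A))\<rparr>"

definition quot_by_elem :: "'a \<Rightarrow> ('a, 'b, 'n) module_scheme \<Rightarrow> ('a set, 'b set) module" where
  "quot_by_elem l N = as_Quot_module (quot_module N ((\<lambda>x. l \<odot>\<^bsub>N\<^esub> x) ` carrier N))"

definition is_lifting ::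
    "('a, 'm) ring_scheme \<Rightarrow> 'a \<Rightarrow> ('a, 'b, 'n) module_scheme \<Rightarrow> ('a set, 'c, 'k) module_scheme \<Rightarrow> bool" where
  "is_lifting S l N M \<longleftrightarrow>
     module S N \<and> module (S Quot (PIdl\<^bsub>S\<^esub> l)) M \<and>
     regular_on l N \<and> module_isomorphic (S Quot (PIdl\<^bsub>S\<^esub> l)) (quot_by_elem l N) M"

lemma (in module) smult_coset:
  assumes "submodule H R M" "a \<in> carrier R" "x \<in> carrier M"
  shows "a \<odot>\<^bsub>quot_module M H\<^esub> (H +>\<^bsub>M\<^esub> x) = H +>\<^bsub>M\<^esub> (a \<odot>\<^bsub>M\<^esub> x)"
proof -
  interpret H: submodule H R M by fact
  have sg: "subgroup H (add_monoid M)" ..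
  have "H +>\<^bsub>M\<^esub> (a \<odot>\<^bsub>M\<^esub> y) = H +>\<^bsub>M\<^esub> (a \<odot>\<^bsub>M\<^esub> x)" if "y \<in> H +>\<^bsub>M\<^esub> x" for y
  proof -
    from that obtain h where h: "h \<in> H" "y = h \<oplus>\<^bsub>M\<^esub> x" by (auto simp: a_r_coset_def')
    have hc: "h \<in> carrier M" using h(1) submoduleE(1)[OF assms(1)] by blast
    have "a \<odot>\<^bsub>M\<^esub> y = (a \<odot>\<^bsub>M\<^esub> h) \<oplus>\<^bsub>M\<^esub> (a \<odot>\<^bsub>M\<^esub> x)"
      using h hc assms by (simp add: smult_r_distr)
    hence "a \<odot>\<^bsub>M\<^esub> y \<in> H +>\<^bsub>M\<^esub> (a \<odot>\<^bsub>M\<^esub> x)"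
      using H.smult_closed[OF assms(2) h(1)] by (auto simp: a_r_coset_def')
    thus ?thesis using M.a_repr_independence[OF _ _ sg] assms by auto
  qed
  moreover have "x \<in> H +>\<^bsub>M\<^esub> x" using M.add.rcos_self[OF assms(3) sg] by (simp add: a_r_coset_def)
  ultimately have "(\<Union>y\<in>H +>\<^bsub>M\<^esub> x. H +>\<^bsub>M\<^esub> (a \<odot>\<^bsub>M\<^esub> y)) = H +>\<^bsub>M\<^esub> (a \<odot>\<^bsub>M\<^esub> x)"
    by (metis (no_types, lifting) UN_constant_eq)
  thus ?thesis by (simp add: quot_module_def)
qed

lemma (in module) module_quot_module:
  assumes "submodule H R M"
  shows "module R (quot_module M H)"
proof -
  interpret H: submodule H R M by fact
  have sg: "subgroup H (add_monoid M)" ..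
  have asg: "abelian_subgroup H M"
    by (intro abelian_subgroupI3 additive_subgroupI sg M.abelian_group_axioms)
  interpret Q: abelian_subgroup H M by fact
  have "comm_group (M A_Mod H)" by (rule Q.a_factorgroup_is_comm_group)
  then interpret C: comm_group "M A_Mod H" .
  have eq: "carrier (M A_Mod H) = carrier (quot_module M H)"
    "mult (M A_Mod H) = add (quot_module M H)" "one (M A_Mod H) = zero (quot_module M H)"
    by (simp_all add: A_FactGroup_def FactGroup_def quot_module_def set_add_def A_RCOSETS_def)
  have "abelian_group (quot_module M H)"
    using C.m_closed C.one_closed C.m_assoc C.m_comm C.l_one C.l_inv_ex unfolding eq
    by (intro abelian_groupI) auto
  have car: thesis
    if "A \<in> carrier (quot_module M H)" "\<And>x. x \<in> carrier M \<Longrightarrow> A = H +>\<^bsub>M\<^esub> x \<Longrightarrow> thesis"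
    for A thesis
    using that by (auto simp: quot_module_def A_RCOSETS_def')
  have inc: "H +>\<^bsub>M\<^esub> x \<in> carrier (quot_module M H)" if "x \<in> carrier M" for x
    using that by (auto simp: quot_module_def A_RCOSETS_def')
  have add: "(H +>\<^bsub>M\<^esub> x) \<oplus>\<^bsub>quot_module M H\<^esub> (H +>\<^bsub>M\<^esub> y) = H +>\<^bsub>M\<^esub> (x \<oplus>\<^bsub>M\<^esub> y)"
    if "x \<in> carrier M" "y \<in> carrier M" for x y
    using that Q.a_rcos_sum by (simp add: quot_module_def)
  note smult = smult_coset[OF assms]
  show ?thesis
  proof (rule moduleI)
    show "cring R" by (rule R.is_cring)
    show "abelian_group (quot_module M H)" by fact
    fix a A assume a: "a \<in> carrier R" and A: "A \<in> carrier (quot_module M H)"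
    obtain x where x: "x \<in> carrier M" "A = H +>\<^bsub>M\<^esub> x" using A by (rule car)
    show "a \<odot>\<^bsub>quot_module M H\<^esub> A \<in> carrier (quot_module M H)"
      using a x by (simp add: smult inc)
    fix B assume B: "B \<in> carrier (quot_module M H)"
    obtain y where y: "y \<in> carrier M" "B = H +>\<^bsub>M\<^esub> y" using B by (rule car)
    show "a \<odot>\<^bsub>quot_module M H\<^esub> (A \<oplus>\<^bsub>quot_module M H\<^esub> B) =
        a \<odot>\<^bsub>quot_module M H\<^esub> A \<oplus>\<^bsub>quot_module M H\<^esub> a \<odot>\<^bsub>quot_module M H\<^esub> B"
      using a x y by (simp add: add smult smult_r_distr)
  next
    fix a b A assume a: "a \<in> carrier R" and b: "b \<in> carrier R"
      and A: "A \<in> carrier (quot_module M H)"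
    obtain x where x: "x \<in> carrier M" "A = H +>\<^bsub>M\<^esub> x" using A by (rule car)
    show "(a \<oplus>\<^bsub>R\<^esub> b) \<odot>\<^bsub>quot_module M H\<^esub> A =
        a \<odot>\<^bsub>quot_module M H\<^esub> A \<oplus>\<^bsub>quot_module M H\<^esub> b \<odot>\<^bsub>quot_module M H\<^esub> A"
      using a b x by (simp add: add smult smult_l_distr)
    show "(a \<otimes>\<^bsub>R\<^esub> b) \<odot>\<^bsub>quot_module M H\<^esub> A =
        a \<odot>\<^bsub>quot_module M H\<^esub> (b \<odot>\<^bsub>quot_module M H\<^esub> A)"
      using a b x by (simp add: smult smult_assoc1)
  next
    fix A assume A: "A \<in> carrier (quot_module M H)"
    obtain x where x: "x \<in> carrier M" "A = H +>\<^bsub>M\<^esub> x" using A by (rule car)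
    show "\<one>\<^bsub>R\<^esub> \<odot>\<^bsub>quot_module M H\<^esub> A = A" using x by (simp add: smult)
  qed
qed

lemma (in module) smult_as_Quot_module:
  assumes "ideal I R" and "\<And>a x. a \<in> I \<Longrightarrow> x \<in> carrier M \<Longrightarrow> a \<odot>\<^bsub>M\<^esub> x = \<zero>\<^bsub>M\<^esub>"
    and "a \<in> carrier R" "x \<in> carrier M"
  shows "(I +>\<^bsub>R\<^esub> a) \<odot>\<^bsub>as_Quot_module M\<^esub> x = a \<odot>\<^bsub>M\<^esub> x"
proof -
  interpret I: ideal I R by fact
  have "(\<lambda>b. b \<odot>\<^bsub>M\<^esub> x) ` (I +>\<^bsub>R\<^esub> a) = {a \<odot>\<^bsub>M\<^esub> x}"
    using assms(2-4) I.a_subset I.zero_closed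
    by (force simp: a_r_coset_def' smult_l_distr)
  thus ?thesis by (simp add: as_Quot_module_def)
qed

lemma (in module) module_as_Quot_module:
  assumes "ideal I R" and "\<And>a x. a \<in> I \<Longrightarrow> x \<in> carrier M \<Longrightarrow> a \<odot>\<^bsub>M\<^esub> x = \<zero>\<^bsub>M\<^esub>"
  shows "module (R Quot I) (as_Quot_module M)"
proof -
  interpret I: ideal I R by fact
  have "abelian_group (as_Quot_module M)"
    using M.add.l_inv_ex
    by (intro abelian_groupI) (auto simp: as_Quot_module_def M.add.m_ac)
  have car: thesis
    if "A \<in> carrier (R Quot I)" "\<And>a. a \<in> carrier R \<Longrightarrow> A = I +>\<^bsub>R\<^esub> a \<Longrightarrow> thesis" for A thesis
    using that by (auto simp: FactRing_def A_RCOSETS_def')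
  have quot: "(I +>\<^bsub>R\<^esub> a) \<oplus>\<^bsub>R Quot I\<^esub> (I +>\<^bsub>R\<^esub> b) = I +>\<^bsub>R\<^esub> (a \<oplus>\<^bsub>R\<^esub> b)"
    "(I +>\<^bsub>R\<^esub> a) \<otimes>\<^bsub>R Quot I\<^esub> (I +>\<^bsub>R\<^esub> b) = I +>\<^bsub>R\<^esub> (a \<otimes>\<^bsub>R\<^esub> b)"
    if "a \<in> carrier R" "b \<in> carrier R" for a b
    using that by (simp_all add: FactRing_def I.a_rcos_sum I.rcoset_mult_add)
  have one: "\<one>\<^bsub>R Quot I\<^esub> = I +>\<^bsub>R\<^esub> \<one>\<^bsub>R\<^esub>" by (simp add: FactRing_def)
  have fields: "carrier (as_Quot_module M) = carrier M" "add (as_Quot_module M) = add M"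
    by (simp_all add: as_Quot_module_def)
  note smult = smult_as_Quot_module[OF assms]
  show ?thesis
  proof (rule moduleI, unfold fields)
    show "cring (R Quot I)" by (rule I.quotient_is_cring[OF R.is_cring])
    show "abelian_group (as_Quot_module M)" by fact
    fix A x assume A: "A \<in> carrier (R Quot I)" and x: "x \<in> carrier M"
    obtain a where a: "a \<in> carrier R" "A = I +>\<^bsub>R\<^esub> a" using A by (rule car)
    show "A \<odot>\<^bsub>as_Quot_module M\<^esub> x \<in> carrier M" using a x by (simp add: smult)
    fix y assume y: "y \<in> carrier M"
    show "A \<odot>\<^bsub>as_Quot_module M\<^esub> (x \<oplus>\<^bsub>M\<^esub> y) =
        A \<odot>\<^bsub>as_Quot_module M\<^esub> x \<oplus>\<^bsub>M\<^esub> A \<odot>\<^bsub>as_Quot_module M\<^esub> y"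
      using a x y by (simp add: smult smult_r_distr)
  next
    fix A B x assume A: "A \<in> carrier (R Quot I)" and B: "B \<in> carrier (R Quot I)"
      and x: "x \<in> carrier M"
    obtain a where a: "a \<in> carrier R" "A = I +>\<^bsub>R\<^esub> a" using A by (rule car)
    obtain b where b: "b \<in> carrier R" "B = I +>\<^bsub>R\<^esub> b" using B by (rule car)
    show "(A \<oplus>\<^bsub>R Quot I\<^esub> B) \<odot>\<^bsub>as_Quot_module M\<^esub> x =
        A \<odot>\<^bsub>as_Quot_module M\<^esub> x \<oplus>\<^bsub>M\<^esub> B \<odot>\<^bsub>as_Quot_module M\<^esub> x"
      using a b x by (simp add: quot smult smult_l_distr)
    show "(A \<otimes>\<^bsub>R Quot I\<^esub> B) \<odot>\<^bsub>as_Quot_module M\<^esub> x =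
        A \<odot>\<^bsub>as_Quot_module M\<^esub> (B \<odot>\<^bsub>as_Quot_module M\<^esub> x)"
      using a b x by (simp add: quot smult smult_assoc1)
  next
    fix x assume x: "x \<in> carrier M"
    show "\<one>\<^bsub>R Quot I\<^esub> \<odot>\<^bsub>as_Quot_module M\<^esub> x = x"
      using x by (simp add: one smult)
  qed
qed

end

theory Submission
  imports Defs
begin

text \<open>
  Put \<open>N = coker g1 = G0 / g1 G1\<close>. Being a lifting of \<open>coker f1\<close> consists of two conditions, one of
  which is automatic.

  The isomorphism \<open>N / l N \<cong> coker f1\<close> always holds. Both sides are images of \<open>G0\<close>, the left one by
  construction and the right one through \<open>p0\<close>. Since \<open>p0\<close> has kernel \<open>l G0\<close> and \<open>p1\<close> is onto, both maps
  from \<open>G0\<close> have kernel \<open>g1 G1 + l G0\<close>, so the two images are isomorphic over \<open>S\<close>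
  (\<open>coker_mod_elem_isomorphic\<close>). Both are annihilated by \<open>l\<close>, which makes the isomorphism linear over
  \<open>S/(l)\<close> (\<open>quot_by_elem_coker_isomorphic\<close>).

  Regularity of \<open>l\<close> on \<open>N\<close> is therefore the whole content, and it is equivalent to
  \<open>g1 (g2 G2) \<subseteq> l g1 G1\<close> by a diagram chase (\<open>regular_on_coker_iff\<close>): because \<open>F2 \<rightarrow> F1 \<rightarrow> F0\<close> is exact,
  the relations \<open>l x \<in> g1 G1\<close> with \<open>x\<close> in \<open>G0\<close> come, up to the trivial ones with \<open>x \<in> g1 G1\<close>, exactly
  from the elements \<open>g1 (g2 y)\<close>, each of which is divisible by \<open>l\<close> in \<open>G0\<close>.
\<close>

section \<open>Homomorphisms of modules\<close>

lemma module_homs_abelian_group_hom: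
  assumes "module R M" "module R N" "f \<in> module_homs R M N"
  shows "abelian_group_hom M N f"
proof -
  interpret M: module R M by fact
  interpret N: module R N by fact
  have "f \<in> hom (add_monoid M) (add_monoid N)"
    using assms(3) by (simp add: module_homs_def)
  hence "group_hom (add_monoid M) (add_monoid N) f"
    by (intro group_hom.intro group_hom_axioms.intro M.a_group N.a_group)
  thus ?thesis
    by (rule abelian_group_homI[OF M.abelian_group_axioms N.abelian_group_axioms])
qed

lemma module_homs_smult:
  assumes "f \<in> module_homs R M N" "a \<in> carrier R" "x \<in> carrier M"
  shows "f (a \<odot>\<^bsub>M\<^esub> x) = a \<odot>\<^bsub>N\<^esub> f x"
  using assms by (simp add: module_homs_def)

lemma module_homsI:
  assumes "\<And>x. x \<in> carrier M \<Longrightarrow> f x \<in> carrier N"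
    and "\<And>x y. x \<in> carrier M \<Longrightarrow> y \<in> carrier M \<Longrightarrow> f (x \<oplus>\<^bsub>M\<^esub> y) = f x \<oplus>\<^bsub>N\<^esub> f y"
    and "\<And>a x. a \<in> carrier R \<Longrightarrow> x \<in> carrier M \<Longrightarrow> f (a \<odot>\<^bsub>M\<^esub> x) = a \<odot>\<^bsub>N\<^esub> f x"
  shows "f \<in> module_homs R M N"
  using assms by (auto simp: module_homs_def hom_def)

lemma module_homs_comp:
  assumes "f \<in> module_homs R L M" "g \<in> module_homs R M N"
  shows "(\<lambda>x. g (f x)) \<in> module_homs R L N"
  using assms by (auto simp: module_homs_def hom_def Pi_def)

lemma (in abelian_group) minus_eq_zero_iff:
  assumes "x \<in> carrier G" "y \<in> carrier G"
  shows "x \<ominus> y = \<zero> \<longleftrightarrow> x = y"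
proof
  assume "x \<ominus> y = \<zero>"
  hence "\<ominus> (\<ominus> y) = x" using assms by (intro minus_equality) (simp_all add: minus_eq)
  thus "x = y" using assms by simp
qed (use assms in \<open>simp add: minus_eq r_neg\<close>)

lemma (in abelian_group) minus_minus_cancel:
  assumes "x \<in> carrier G" "y \<in> carrier G"
  shows "x \<ominus> (x \<ominus> y) = y"
  using assms by (simp add: minus_eq minus_add r_neg1 r_neg2)

lemma (in abelian_group) minus_add_cancel:
  assumes "x \<in> carrier G" "y \<in> carrier G"
  shows "(x \<ominus> y) \<oplus> y = x"
  using assms by (simp add: minus_eq a_assoc l_neg)

lemma (in abelian_group_hom) hom_eq_iff_diff_in_kernel:
  assumes "x \<in> carrier G" "y \<in> carrier G"
  shows "h x = h y \<longleftrightarrow> x \<ominus>\<^bsub>G\<^esub> y \<in> a_kernel G H h"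
proof -
  have "h (x \<ominus>\<^bsub>G\<^esub> y) = h x \<ominus>\<^bsub>H\<^esub> h y"
    using assms by (simp only: G.minus_eq H.minus_eq hom_add G.a_inv_closed hom_a_inv)
  thus ?thesis
    using assms
    by (simp only: a_kernel_def' mem_Collect_eq H.minus_eq_zero_iff hom_closed G.minus_closed
        simp_thms)
qed

lemma submodule_image:
  assumes "module R M" "module R N" "f \<in> module_homs R M N"
  shows "submodule (f ` carrier M) R N"
proof -
  interpret M: module R M by fact
  interpret N: module R N by fact
  interpret f: abelian_group_hom M N f by (rule module_homs_abelian_group_hom[OF assms])
  show ?thesis
  proof (rule N.submoduleI)
    show "\<zero>\<^bsub>N\<^esub> \<in> f ` carrier M"
      by (rule image_eqI[of _ _ "\<zero>\<^bsub>M\<^esub>"]) simp_all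
    fix y assume "y \<in> f ` carrier M"
    then obtain x where x: "x \<in> carrier M" "y = f x" by blast
    show "\<ominus>\<^bsub>N\<^esub> y \<in> f ` carrier M"
      by (rule image_eqI[of _ _ "\<ominus>\<^bsub>M\<^esub> x"]) (use x in simp_all)
    show "a \<odot>\<^bsub>N\<^esub> y \<in> f ` carrier M" if "a \<in> carrier R" for a
      by (rule image_eqI[of _ _ "a \<odot>\<^bsub>M\<^esub> x"])
        (use x that module_homs_smult[OF assms(3)] in simp_all)
    fix z assume "z \<in> f ` carrier M"
    then obtain w where w: "w \<in> carrier M" "z = f w" by blast
    show "y \<oplus>\<^bsub>N\<^esub> z \<in> f ` carrier M"
      by (rule image_eqI[of _ _ "x \<oplus>\<^bsub>M\<^esub> w"]) (use x w in simp_all)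
  qed auto
qed

lemma (in module) smult_in_module_homs:
  assumes "a \<in> carrier R"
  shows "(\<lambda>x. a \<odot>\<^bsub>M\<^esub> x) \<in> module_homs R M M"
proof (rule module_homsI)
  show "a \<odot>\<^bsub>M\<^esub> (b \<odot>\<^bsub>M\<^esub> x) = b \<odot>\<^bsub>M\<^esub> (a \<odot>\<^bsub>M\<^esub> x)"
    if "b \<in> carrier R" "x \<in> carrier M" for b x
    using that assms by (simp flip: smult_assoc1 add: R.m_comm)
qed (use assms in \<open>simp_all add: smult_r_distr\<close>)

text \<open>
  A form of the first isomorphism theorem that compares two quotients of \<open>M\<close> given by unrelated
  constructions. Sending \<open>f x\<close> to \<open>g x\<close> is well defined and injective because each of \<open>f\<close> and \<open>g\<close>
  identifies two elements exactly when their difference lies in the common kernel.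
\<close>

lemma isomorphic_if_equal_kernels:
  assumes "module R M" "module R N" "module R P"
    and f: "f \<in> module_homs R M N" "f ` carrier M = carrier N"
    and g: "g \<in> module_homs R M P" "g ` carrier M = carrier P"
    and ker: "a_kernel M N f = a_kernel M P g"
  shows "module_isomorphic R N P"
proof -
  interpret M: module R M by fact
  interpret N: module R N by fact
  interpret P: module R P by fact
  interpret f: abelian_group_hom M N f
    by (rule module_homs_abelian_group_hom[OF assms(1,2) f(1)])
  interpret g: abelian_group_hom M P g
    by (rule module_homs_abelian_group_hom[OF assms(1,3) g(1)])
  have same: "f x = f y \<longleftrightarrow> g x = g y" if "x \<in> carrier M" "y \<in> carrier M" for x y
    using that by (simp add: f.hom_eq_iff_diff_in_kernel g.hom_eq_iff_diff_in_kernel ker)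
  define h where "h n = g (inv_into (carrier M) f n)" for n
  have hf: "h (f x) = g x" if "x \<in> carrier M" for x
  proof -
    have "inv_into (carrier M) f (f x) \<in> carrier M" "f (inv_into (carrier M) f (f x)) = f x"
      using that by (auto intro: inv_into_into f_inv_into_f)
    thus ?thesis using same that by (simp add: h_def)
  qed
  have "h \<in> module_homs R N P"
  proof (rule module_homsI, goal_cases)
    case (1 n)
    then obtain x where "x \<in> carrier M" "n = f x" using f(2) by blast
    thus ?case by (simp add: hf)
  next
    case (2 n m)
    then obtain x y where "x \<in> carrier M" "n = f x" "y \<in> carrier M" "m = f y"
      using f(2) by blast
    thus ?case by (simp add: hf flip: f.hom_add)
  next
    case (3 a n)
    then obtain x where "x \<in> carrier M" "n = f x" using f(2) by blast
    thus ?case using 3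
      by (simp add: hf module_homs_smult[OF g(1)] flip: module_homs_smult[OF f(1)])
  qed
  moreover have "bij_betw h (carrier N) (carrier P)"
    unfolding bij_betw_def
  proof
    show "inj_on h (carrier N)"
      unfolding f(2)[symmetric] by (auto intro!: inj_onI simp: hf same)
    show "h ` carrier N = carrier P"
      unfolding f(2)[symmetric] g(2)[symmetric] by (simp add: image_image hf)
  qed
  ultimately show ?thesis unfolding module_isomorphic_def by blast
qed

section \<open>Quotient modules\<close>

lemma (in module) coset_in_module_homs:
  assumes "submodule H R M"
  shows "(\<lambda>x. H +>\<^bsub>M\<^esub> x) \<in> module_homs R M (quot_module M H)"
proof -
  interpret H: submodule H R M by fact
  interpret Q: abelian_subgroup H M
    by (intro abelian_subgroupI3 additive_subgroupI H.subgroup_axioms M.abelian_group_axioms)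
  show ?thesis
  proof (rule module_homsI)
    show "H +>\<^bsub>M\<^esub> x \<in> carrier (quot_module M H)" if "x \<in> carrier M" for x
      using that by (auto simp: quot_module_def A_RCOSETS_def')
  qed (simp_all add: smult_coset[OF assms], simp add: quot_module_def Q.a_rcos_sum)
qed

lemma carrier_quot_module:
  "carrier (quot_module M H) = (\<lambda>x. H +>\<^bsub>M\<^esub> x) ` carrier M"
  by (auto simp: quot_module_def A_RCOSETS_def')

lemma (in module) kernel_coset:
  assumes "submodule H R M"
  shows "a_kernel M (quot_module M H) (\<lambda>x. H +>\<^bsub>M\<^esub> x) = H"
proof -
  interpret H: submodule H R M by fact
  have sg: "subgroup H (add_monoid M)" ..
  have "H \<subseteq> carrier M" by (rule submoduleE(1)[OF assms])
  thus ?thesis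
    using M.a_coset_join1[OF _ _ sg] M.a_coset_join2[OF _ sg]
    by (auto simp: a_kernel_def' quot_module_def)
qed

lemma (in module) coset_eq_zero_iff:
  assumes "submodule H R M" "x \<in> carrier M"
  shows "H +>\<^bsub>M\<^esub> x = \<zero>\<^bsub>quot_module M H\<^esub> \<longleftrightarrow> x \<in> H"
  using kernel_coset[OF assms(1)] assms(2) by (auto simp: a_kernel_def')

lemma (in module) coset_eq_iff:
  assumes "submodule H R M" "x \<in> carrier M" "y \<in> carrier M"
  shows "H +>\<^bsub>M\<^esub> x = H +>\<^bsub>M\<^esub> y \<longleftrightarrow> x \<ominus>\<^bsub>M\<^esub> y \<in> H"
proof -
  interpret \<pi>: abelian_group_hom M "quot_module M H" "\<lambda>x. H +>\<^bsub>M\<^esub> x"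
    by (rule module_homs_abelian_group_hom[OF module_axioms module_quot_module coset_in_module_homs])
      fact+
  show ?thesis
    using \<pi>.hom_eq_iff_diff_in_kernel[OF assms(2,3)] by (simp add: kernel_coset[OF assms(1)])
qed

lemma (in module) quot_module_annihilated:
  assumes H: "submodule H R M" and a: "a \<in> carrier R"
    and aM: "\<And>x. x \<in> carrier M \<Longrightarrow> a \<odot>\<^bsub>M\<^esub> x \<in> H"
    and X: "X \<in> carrier (quot_module M H)"
  shows "a \<odot>\<^bsub>quot_module M H\<^esub> X = \<zero>\<^bsub>quot_module M H\<^esub>"
proof -
  obtain x where x: "x \<in> carrier M" "X = H +>\<^bsub>M\<^esub> x"
    using X unfolding carrier_quot_module by blast
  show ?thesis
    unfolding x(2) smult_coset[OF H a x(1)] coset_eq_zero_iff[OF H smult_closed[OF a x(1)]]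
    by (rule aM[OF x(1)])
qed

lemma (in module) regular_on_iff:
  assumes "a \<in> carrier R"
  shows "regular_on a M \<longleftrightarrow> (\<forall>x\<in>carrier M. a \<odot>\<^bsub>M\<^esub> x = \<zero>\<^bsub>M\<^esub> \<longrightarrow> x = \<zero>\<^bsub>M\<^esub>)"
proof (intro iffI ballI impI)
  fix x assume reg: "regular_on a M" and x: "x \<in> carrier M" "a \<odot>\<^bsub>M\<^esub> x = \<zero>\<^bsub>M\<^esub>"
  have "a \<odot>\<^bsub>M\<^esub> x = a \<odot>\<^bsub>M\<^esub> \<zero>\<^bsub>M\<^esub>" unfolding x(2) smult_r_null[OF assms] ..
  thus "x = \<zero>\<^bsub>M\<^esub>"
    by (rule inj_onD[OF reg[unfolded regular_on_def] _ x(1) M.zero_closed])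
next
  assume *: "\<forall>x\<in>carrier M. a \<odot>\<^bsub>M\<^esub> x = \<zero>\<^bsub>M\<^esub> \<longrightarrow> x = \<zero>\<^bsub>M\<^esub>"
  have hom: "abelian_group_hom M M (\<lambda>x. a \<odot>\<^bsub>M\<^esub> x)"
    by (rule module_homs_abelian_group_hom[OF module_axioms module_axioms
          smult_in_module_homs[OF assms]])
  show "regular_on a M"
    unfolding regular_on_def
  proof (rule inj_onI)
    fix x y assume xy: "x \<in> carrier M" "y \<in> carrier M" "a \<odot>\<^bsub>M\<^esub> x = a \<odot>\<^bsub>M\<^esub> y"
    have "x \<ominus>\<^bsub>M\<^esub> y \<in> a_kernel M M (\<lambda>x. a \<odot>\<^bsub>M\<^esub> x)"
      using abelian_group_hom.hom_eq_iff_diff_in_kernel[OF hom xy(1,2)] xy(3) by blast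
    hence "x \<ominus>\<^bsub>M\<^esub> y \<in> carrier M" "a \<odot>\<^bsub>M\<^esub> (x \<ominus>\<^bsub>M\<^esub> y) = \<zero>\<^bsub>M\<^esub>"
      by (simp_all add: a_kernel_def')
    with * have "x \<ominus>\<^bsub>M\<^esub> y = \<zero>\<^bsub>M\<^esub>" by blast
    thus "x = y" using M.minus_eq_zero_iff[OF xy(1,2)] by blast
  qed
qed

lemma (in module) regular_on_quot_module_iff:
  assumes H: "submodule H R M" and a: "a \<in> carrier R"
  shows "regular_on a (quot_module M H) \<longleftrightarrow> (\<forall>x\<in>carrier M. a \<odot>\<^bsub>M\<^esub> x \<in> H \<longrightarrow> x \<in> H)"
proof -
  interpret Q: module R "quot_module M H" by (rule module_quot_module[OF H])
  show ?thesis
    using a by (simp add: Q.regular_on_iff carrier_quot_module smult_coset[OF H]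
        coset_eq_zero_iff[OF H])
qed

section \<open>Modules annihilated by an ideal\<close>

lemma as_Quot_module_simps:
  "carrier (as_Quot_module M) = carrier M" "add (as_Quot_module M) = add M"
  "zero (as_Quot_module M) = zero M"
  by (simp_all add: as_Quot_module_def)

lemma (in module) PIdl_annihilates:
  assumes a: "a \<in> carrier R" and "\<And>x. x \<in> carrier M \<Longrightarrow> a \<odot>\<^bsub>M\<^esub> x = \<zero>\<^bsub>M\<^esub>"
    and "b \<in> PIdl a" "x \<in> carrier M"
  shows "b \<odot>\<^bsub>M\<^esub> x = \<zero>\<^bsub>M\<^esub>"
  using assms by (auto simp: cgenideal_def smult_assoc1)

lemma carrier_Quot:
  "carrier (R Quot I) = (\<lambda>a. I +>\<^bsub>R\<^esub> a) ` carrier R"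
  by (auto simp: FactRing_def A_RCOSETS_def')

lemma module_homs_as_Quot_module:
  assumes "module R M" "module R N" "ideal I R"
    and M: "\<And>a x. a \<in> I \<Longrightarrow> x \<in> carrier M \<Longrightarrow> a \<odot>\<^bsub>M\<^esub> x = \<zero>\<^bsub>M\<^esub>"
    and N: "\<And>a x. a \<in> I \<Longrightarrow> x \<in> carrier N \<Longrightarrow> a \<odot>\<^bsub>N\<^esub> x = \<zero>\<^bsub>N\<^esub>"
    and f: "f \<in> module_homs R M N"
  shows "f \<in> module_homs (R Quot I) (as_Quot_module M) (as_Quot_module N)"
proof -
  interpret M: module R M by fact
  interpret N: module R N by fact
  interpret f: abelian_group_hom M N f by (rule module_homs_abelian_group_hom) fact+
  note smult = M.smult_as_Quot_module[OF assms(3) M] N.smult_as_Quot_module[OF assms(3) N]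
  show ?thesis
    by (rule module_homsI)
      (auto simp: as_Quot_module_simps carrier_Quot smult module_homs_smult[OF f])
qed

lemma module_isomorphic_as_Quot_module:
  assumes "module R M" "module R N" "ideal I R"
    and "\<And>a x. a \<in> I \<Longrightarrow> x \<in> carrier M \<Longrightarrow> a \<odot>\<^bsub>M\<^esub> x = \<zero>\<^bsub>M\<^esub>"
    and "\<And>a x. a \<in> I \<Longrightarrow> x \<in> carrier N \<Longrightarrow> a \<odot>\<^bsub>N\<^esub> x = \<zero>\<^bsub>N\<^esub>"
    and "module_isomorphic R M N"
  shows "module_isomorphic (R Quot I) (as_Quot_module M) (as_Quot_module N)"
  using assms(6) module_homs_as_Quot_module[OF assms(1-5)]
  by (auto simp: module_isomorphic_def as_Quot_module_simps)

text \<open>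
  The values of scalar multiplication outside the carrier are arbitrary, so isomorphism only sees
  the operations of a module on its carrier.
\<close>

lemma module_isomorphic_cong:
  assumes "carrier N = carrier P" "add N = add P"
    and "\<And>a x. a \<in> carrier R \<Longrightarrow> x \<in> carrier P \<Longrightarrow> a \<odot>\<^bsub>N\<^esub> x = a \<odot>\<^bsub>P\<^esub> x"
    and "module_isomorphic R M N"
  shows "module_isomorphic R M P"
proof -
  obtain f where f: "f \<in> module_homs R M N" "bij_betw f (carrier M) (carrier N)"
    using assms(4) by (auto simp: module_isomorphic_def)
  have "f \<in> module_homs R M P"
    using f(1) assms(1-3) by (auto simp: module_homs_def hom_def Pi_def)
  with f(2) show ?thesis unfolding module_isomorphic_def assms(1) by blast
qed

lemma quot_module_as_Quot_module_simps:
  "carrier (quot_module (as_Quot_module M) H) = carrier (quot_module M H)"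
  "add (quot_module (as_Quot_module M) H) = add (quot_module M H)"
  "H +>\<^bsub>as_Quot_module M\<^esub> x = H +>\<^bsub>M\<^esub> x"
  by (simp_all add: quot_module_def as_Quot_module_simps A_RCOSETS_def a_r_coset_def
      RCOSETS_def r_coset_def set_add_def set_mult_def fun_eq_iff)

text \<open>
  Passing to the quotient by \<open>H\<close> commutes with descending the scalars from \<open>R\<close> to \<open>R/I\<close>: in either
  order, the class of \<open>a\<close> sends the class of \<open>x\<close> to the class of \<open>a x\<close>.
\<close>

lemma (in module) smult_quot_module_as_Quot_module:
  assumes I: "ideal I R" and ann: "\<And>a x. a \<in> I \<Longrightarrow> x \<in> carrier M \<Longrightarrow> a \<odot>\<^bsub>M\<^esub> x = \<zero>\<^bsub>M\<^esub>"
    and H: "submodule H R M" and H': "submodule H (R Quot I) (as_Quot_module M)"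
    and A: "A \<in> carrier (R Quot I)" and X: "X \<in> carrier (quot_module M H)"
  shows "A \<odot>\<^bsub>as_Quot_module (quot_module M H)\<^esub> X = A \<odot>\<^bsub>quot_module (as_Quot_module M) H\<^esub> X"
proof -
  interpret Q: module R "quot_module M H" by (rule module_quot_module[OF H])
  interpret R: module "R Quot I" "as_Quot_module M" by (rule module_as_Quot_module[OF I ann])
  have annQ: "a \<odot>\<^bsub>quot_module M H\<^esub> X = \<zero>\<^bsub>quot_module M H\<^esub>"
    if aI: "a \<in> I" and "X \<in> carrier (quot_module M H)" for a X
  proof (rule quot_module_annihilated[OF H ideal.Icarr[OF I aI] _ that(2)])
    show "a \<odot>\<^bsub>M\<^esub> x \<in> H" if "x \<in> carrier M" for x
      using ann[OF aI that] subgroup.one_closed[OF submodule.axioms(1)[OF H]] by simp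
  qed
  obtain a where a: "a \<in> carrier R" "A = I +>\<^bsub>R\<^esub> a" using A by (auto simp: carrier_Quot)
  obtain x where x: "x \<in> carrier M" "X = H +>\<^bsub>M\<^esub> x" using X by (auto simp: carrier_quot_module)
  have "A \<odot>\<^bsub>as_Quot_module (quot_module M H)\<^esub> X = H +>\<^bsub>M\<^esub> (a \<odot>\<^bsub>M\<^esub> x)"
    using Q.smult_as_Quot_module[OF I annQ a(1) X] a x by (simp add: smult_coset[OF H])
  moreover have "A \<odot>\<^bsub>quot_module (as_Quot_module M) H\<^esub> X = H +>\<^bsub>M\<^esub> (a \<odot>\<^bsub>M\<^esub> x)"
    using R.smult_coset[OF H' A, of x] a x
    by (simp add: quot_module_as_Quot_module_simps as_Quot_module_simps smult_as_Quot_module[OF I ann])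
  ultimately show ?thesis by simp
qed

section \<open>The cokernels\<close>

lemma short_exact_smult_annihilates:
  assumes "module R G" "short_exact R G (\<lambda>x. l \<odot>\<^bsub>G\<^esub> x) G p F" "l \<in> carrier R" "y \<in> carrier F"
  shows "l \<odot>\<^bsub>F\<^esub> y = \<zero>\<^bsub>F\<^esub>"
proof -
  interpret G: module R G by fact
  have p: "p \<in> module_homs R G F" "p ` carrier G = carrier F"
    "(\<lambda>x. l \<odot>\<^bsub>G\<^esub> x) ` carrier G = a_kernel G F p"
    using assms(2) by (auto simp: short_exact_def exact_at_def)
  obtain x where x: "x \<in> carrier G" "y = p x" using p(2) assms(4) by blast
  have "l \<odot>\<^bsub>G\<^esub> x \<in> a_kernel G F p" using x p(3) by blast
  thus ?thesis using x assms(3) module_homs_smult[OF p(1)] by (auto simp: a_kernel_def')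
qed

text \<open>
  Write \<open>B = g1 G1\<close>, so that regularity of \<open>l\<close> on \<open>G0 / B\<close> says that \<open>l x \<in> B\<close> forces \<open>x \<in> B\<close>.
  Modulo \<open>l\<close> the composite \<open>g1 g2\<close> becomes \<open>f1 f2 = 0\<close>, so each \<open>g1 (g2 y)\<close> is some \<open>l x\<close> and
  regularity puts this \<open>x\<close> into \<open>B\<close>. Conversely, if \<open>l x = g1 z\<close>, then \<open>z\<close> reduces to a
  cycle of \<open>F1\<close>; exactness lifts it to some \<open>y\<close> in \<open>G2\<close> with \<open>z = l w + g2 y\<close>, hence
  \<open>l x = l g1 (w + v)\<close> where \<open>g1 (g2 y) = l g1 v\<close>, and \<open>l\<close> cancels on \<open>G0\<close>.
\<close>

lemma regular_on_coker_iff: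
  assumes S: "l \<in> carrier S" and mods: "module S G0" "module S G1" "module S F0" "module S F1"
    and g2: "g2 \<in> module_homs S G2 G1" and g1: "g1 \<in> module_homs S G1 G0"
    and f1: "f1 \<in> module_homs S F1 F0"
    and ex0: "short_exact S G0 (\<lambda>x. l \<odot>\<^bsub>G0\<^esub> x) G0 p0 F0"
    and ex1: "short_exact S G1 (\<lambda>x. l \<odot>\<^bsub>G1\<^esub> x) G1 p1 F1"
    and p2: "p2 ` carrier G2 = carrier F2"
    and sq2: "\<And>x. x \<in> carrier G2 \<Longrightarrow> p1 (g2 x) = f2 (p2 x)"
    and sq1: "\<And>x. x \<in> carrier G1 \<Longrightarrow> p0 (g1 x) = f1 (p1 x)"
    and exF: "exact_at S F2 f2 F1 f1 F0"
  shows "regular_on l (coker G1 g1 G0) \<longleftrightarrow>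
    (g1 \<circ> g2) ` carrier G2 \<subseteq> (\<lambda>x. l \<odot>\<^bsub>G0\<^esub> x) ` (g1 ` carrier G1)"
proof -
  interpret G0: module S G0 by fact
  interpret G1: module S G1 by fact
  interpret F0: module S F0 by fact
  interpret F1: module S F1 by fact
  have p0: "p0 \<in> module_homs S G0 F0" "inj_on (\<lambda>x. l \<odot>\<^bsub>G0\<^esub> x) (carrier G0)"
    "(\<lambda>x. l \<odot>\<^bsub>G0\<^esub> x) ` carrier G0 = a_kernel G0 F0 p0"
    using ex0 by (auto simp: short_exact_def exact_at_def)
  have p1: "p1 \<in> module_homs S G1 F1" "(\<lambda>x. l \<odot>\<^bsub>G1\<^esub> x) ` carrier G1 = a_kernel G1 F1 p1"
    using ex1 by (auto simp: short_exact_def exact_at_def)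
  have kerF: "f2 ` carrier F2 = a_kernel F1 F0 f1" using exF by (simp add: exact_at_def)
  interpret g1: abelian_group_hom G1 G0 g1 by (rule module_homs_abelian_group_hom) fact+
  interpret p1: abelian_group_hom G1 F1 p1 by (rule module_homs_abelian_group_hom) fact+
  have g2_closed: "g2 y \<in> carrier G1" if "y \<in> carrier G2" for y
    using g2 that by (auto simp: module_homs_def hom_def)
  let ?B = "g1 ` carrier G1"
  have B: "submodule ?B S G0" by (rule submodule_image[OF mods(2,1) g1])
  have "regular_on l (coker G1 g1 G0) \<longleftrightarrow>
      (\<forall>x\<in>carrier G0. l \<odot>\<^bsub>G0\<^esub> x \<in> ?B \<longrightarrow> x \<in> ?B)"
    unfolding coker_def by (rule G0.regular_on_quot_module_iff[OF B S])
  also have "\<dots> \<longleftrightarrow> (g1 \<circ> g2) ` carrier G2 \<subseteq> (\<lambda>x. l \<odot>\<^bsub>G0\<^esub> x) ` ?B"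
  proof
    assume reg: "\<forall>x\<in>carrier G0. l \<odot>\<^bsub>G0\<^esub> x \<in> ?B \<longrightarrow> x \<in> ?B"
    show "(g1 \<circ> g2) ` carrier G2 \<subseteq> (\<lambda>x. l \<odot>\<^bsub>G0\<^esub> x) ` ?B"
    proof clarsimp
      fix y assume y: "y \<in> carrier G2"
      have "f2 (p2 y) \<in> a_kernel F1 F0 f1"
        unfolding kerF[symmetric] p2[symmetric] using y by blast
      hence "p0 (g1 (g2 y)) = \<zero>\<^bsub>F0\<^esub>"
        unfolding sq1[OF g2_closed[OF y]] sq2[OF y] a_kernel_def' by blast
      hence "g1 (g2 y) \<in> a_kernel G0 F0 p0"
        unfolding a_kernel_def' using g1.hom_closed[OF g2_closed[OF y]] by blast
      then obtain x where x: "x \<in> carrier G0" "g1 (g2 y) = l \<odot>\<^bsub>G0\<^esub> x"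
        unfolding p0(3)[symmetric] by blast
      have "l \<odot>\<^bsub>G0\<^esub> x \<in> ?B" using x(2)[symmetric] g2_closed[OF y] by blast
      with reg x show "g1 (g2 y) \<in> (\<lambda>x. l \<odot>\<^bsub>G0\<^esub> x) ` ?B" by blast
    qed
  next
    assume sub: "(g1 \<circ> g2) ` carrier G2 \<subseteq> (\<lambda>x. l \<odot>\<^bsub>G0\<^esub> x) ` ?B"
    show "\<forall>x\<in>carrier G0. l \<odot>\<^bsub>G0\<^esub> x \<in> ?B \<longrightarrow> x \<in> ?B"
    proof (intro ballI impI)
      fix x assume x: "x \<in> carrier G0" and "l \<odot>\<^bsub>G0\<^esub> x \<in> ?B"
      then obtain z where z: "z \<in> carrier G1" "l \<odot>\<^bsub>G0\<^esub> x = g1 z" by blast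
      have "g1 z \<in> a_kernel G0 F0 p0" unfolding z(2)[symmetric] p0(3)[symmetric] using x by blast
      hence "f1 (p1 z) = \<zero>\<^bsub>F0\<^esub>" unfolding sq1[OF z(1), symmetric] a_kernel_def' by blast
      hence "p1 z \<in> f2 ` carrier F2" unfolding kerF a_kernel_def' using p1.hom_closed[OF z(1)] by blast
      then obtain y where y: "y \<in> carrier G2" "p1 z = p1 (g2 y)"
        using p2 sq2 by force
      note g2y = g2_closed[OF y(1)]
      have "z \<ominus>\<^bsub>G1\<^esub> g2 y \<in> a_kernel G1 F1 p1"
        using y(2) p1.hom_eq_iff_diff_in_kernel[OF z(1) g2y] by blast
      then obtain w where w: "w \<in> carrier G1" "z \<ominus>\<^bsub>G1\<^esub> g2 y = l \<odot>\<^bsub>G1\<^esub> w"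
        unfolding p1(2)[symmetric] by blast
      have z_eq: "z = l \<odot>\<^bsub>G1\<^esub> w \<oplus>\<^bsub>G1\<^esub> g2 y"
        unfolding w(2)[symmetric] by (rule G1.M.minus_add_cancel[OF z(1) g2y, symmetric])
      obtain v where v: "v \<in> carrier G1" "g1 (g2 y) = l \<odot>\<^bsub>G0\<^esub> g1 v"
        using subsetD[OF sub imageI[OF y(1)]] unfolding comp_def by blast
      have "l \<odot>\<^bsub>G0\<^esub> x = l \<odot>\<^bsub>G0\<^esub> g1 (w \<oplus>\<^bsub>G1\<^esub> v)"
        using S w(1) v g2y
        by (simp only: z(2) z_eq v(2) module_homs_smult[OF g1] G0.smult_r_distr g1.hom_add
            g1.hom_closed G1.smult_closed)
      hence "x = g1 (w \<oplus>\<^bsub>G1\<^esub> v)"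
        by (rule inj_onD[OF p0(2) _ x g1.hom_closed[OF G1.M.a_closed[OF w(1) v(1)]]])
      thus "x \<in> ?B" using w(1) v(1) by blast
    qed
  qed
  finally show ?thesis .
qed

text \<open>
  Right exactness of reduction modulo \<open>l\<close>, seen from \<open>G0\<close>: both modules are images of \<open>G0\<close>, and an
  element dies in either of them precisely when it lies in \<open>g1 G1 + l G0\<close>.
\<close>

lemma coker_mod_elem_isomorphic:
  assumes S: "l \<in> carrier S"
    and mods: "module S G0" "module S G1" "module S F0" "module S F1"
    and g1: "g1 \<in> module_homs S G1 G0" and f1: "f1 \<in> module_homs S F1 F0"
    and ex0: "short_exact S G0 (\<lambda>x. l \<odot>\<^bsub>G0\<^esub> x) G0 p0 F0"
    and p1: "p1 ` carrier G1 = carrier F1"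
    and sq1: "\<And>x. x \<in> carrier G1 \<Longrightarrow> p0 (g1 x) = f1 (p1 x)"
  defines "N \<equiv> coker G1 g1 G0"
  shows "module_isomorphic S (quot_module N ((\<lambda>x. l \<odot>\<^bsub>N\<^esub> x) ` carrier N)) (coker F1 f1 F0)"
proof -
  interpret G0: module S G0 by fact
  interpret G1: module S G1 by fact
  interpret F0: module S F0 by fact
  have p0: "p0 \<in> module_homs S G0 F0" "p0 ` carrier G0 = carrier F0"
    "(\<lambda>x. l \<odot>\<^bsub>G0\<^esub> x) ` carrier G0 = a_kernel G0 F0 p0"
    using ex0 by (auto simp: short_exact_def exact_at_def)
  interpret g1: abelian_group_hom G1 G0 g1 by (rule module_homs_abelian_group_hom) fact+
  interpret p0: abelian_group_hom G0 F0 p0 by (rule module_homs_abelian_group_hom) fact+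
  let ?B = "g1 ` carrier G1" and ?L = "(\<lambda>x. l \<odot>\<^bsub>N\<^esub> x) ` carrier N" and ?D = "f1 ` carrier F1"
  have B: "submodule ?B S G0" by (rule submodule_image[OF mods(2,1) g1])
  have D: "submodule ?D S F0" by (rule submodule_image[OF mods(4,3) f1])
  have N_def': "N = quot_module G0 ?B" by (simp add: N_def coker_def)
  interpret N: module S N unfolding N_def' by (rule G0.module_quot_module[OF B])
  have L: "submodule ?L S N"
    by (rule submodule_image[OF N.module_axioms N.module_axioms N.smult_in_module_homs[OF S]])
  note carN = carrier_quot_module[of G0 ?B, folded N_def']
  note homN = G0.coset_in_module_homs[OF B, folded N_def']
  let ?\<psi> = "\<lambda>x. ?L +>\<^bsub>N\<^esub> (?B +>\<^bsub>G0\<^esub> x)" and ?\<phi> = "\<lambda>x. ?D +>\<^bsub>F0\<^esub> p0 x"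
  have \<psi>: "?\<psi> \<in> module_homs S G0 (quot_module N ?L)"
    by (rule module_homs_comp[OF homN N.coset_in_module_homs[OF L]])
  have \<phi>: "?\<phi> \<in> module_homs S G0 (coker F1 f1 F0)"
    unfolding coker_def by (rule module_homs_comp[OF p0(1) F0.coset_in_module_homs[OF D]])
  have \<psi>_surj: "?\<psi> ` carrier G0 = carrier (quot_module N ?L)"
    by (simp add: carrier_quot_module carN image_image)
  have \<phi>_surj: "?\<phi> ` carrier G0 = carrier (coker F1 f1 F0)"
    by (simp add: coker_def carrier_quot_module image_image flip: p0(2))
  have "?\<psi> x = \<zero>\<^bsub>quot_module N ?L\<^esub> \<longleftrightarrow> ?\<phi> x = \<zero>\<^bsub>coker F1 f1 F0\<^esub>" if x: "x \<in> carrier G0" for x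
  proof -
    have Bx: "?B +>\<^bsub>G0\<^esub> x \<in> carrier N" using x carN by blast
    have "?\<psi> x = \<zero>\<^bsub>quot_module N ?L\<^esub> \<longleftrightarrow> ?B +>\<^bsub>G0\<^esub> x \<in> ?L"
      by (rule N.coset_eq_zero_iff[OF L Bx])
    also have "\<dots> \<longleftrightarrow> (\<exists>y\<in>carrier G0. ?B +>\<^bsub>G0\<^esub> x = ?B +>\<^bsub>G0\<^esub> (l \<odot>\<^bsub>G0\<^esub> y))"
      unfolding carN using G0.smult_coset[OF B S, folded N_def'] by (auto simp: image_iff)
    also have "\<dots> \<longleftrightarrow> (\<exists>y\<in>carrier G0. x \<ominus>\<^bsub>G0\<^esub> l \<odot>\<^bsub>G0\<^esub> y \<in> ?B)"
      using G0.coset_eq_iff[OF B x] S by simp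
    \<comment> \<open>\<open>x\<close> is a sum of an element of \<open>?B\<close> and one of \<open>l G0\<close>; the two summands change roles.\<close>
    also have "\<dots> \<longleftrightarrow> (\<exists>z\<in>carrier G1. x \<ominus>\<^bsub>G0\<^esub> g1 z \<in> (\<lambda>y. l \<odot>\<^bsub>G0\<^esub> y) ` carrier G0)"
    proof -
      have "x \<ominus>\<^bsub>G0\<^esub> u = v \<longleftrightarrow> x \<ominus>\<^bsub>G0\<^esub> v = u" if "u \<in> carrier G0" "v \<in> carrier G0" for u v
        using G0.minus_minus_cancel[OF x] that by metis
      thus ?thesis using S by (auto simp: image_iff)
    qed
    also have "\<dots> \<longleftrightarrow> (\<exists>z\<in>carrier G1. p0 x = f1 (p1 z))"
      using p0.hom_eq_iff_diff_in_kernel[OF x] by (simp add: p0(3) flip: sq1)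
    also have "\<dots> \<longleftrightarrow> p0 x \<in> ?D" unfolding p1[symmetric] by blast
    also have "\<dots> \<longleftrightarrow> ?\<phi> x = \<zero>\<^bsub>coker F1 f1 F0\<^esub>"
      unfolding coker_def using F0.coset_eq_zero_iff[OF D] x by simp
    finally show ?thesis .
  qed
  hence "a_kernel G0 (quot_module N ?L) ?\<psi> = a_kernel G0 (coker F1 f1 F0) ?\<phi>"
    unfolding a_kernel_def' by blast
  moreover have "module S (quot_module N ?L)" by (rule N.module_quot_module[OF L])
  moreover have "module S (coker F1 f1 F0)"
    unfolding coker_def by (rule F0.module_quot_module[OF D])
  ultimately show ?thesis
    using isomorphic_if_equal_kernels[OF mods(1) _ _ \<psi> \<psi>_surj \<phi> \<phi>_surj] by blast
qed

text \<open>
  The isomorphism over \<open>S\<close> becomes one over \<open>S/(l)\<close>. Forming the cokernel of \<open>f1\<close> over \<open>S\<close> and then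
  descending the scalars need not give the same record as descending first, since the two scalar
  multiplications are only known to agree on the carrier; this is enough for an isomorphism.
\<close>

lemma quot_by_elem_coker_isomorphic:
  assumes S: "cring S" "l \<in> carrier S"
    and mods: "module S G0" "module S G1" "module S F0" "module S F1"
    and g1: "g1 \<in> module_homs S G1 G0" and f1: "f1 \<in> module_homs S F1 F0"
    and ex0: "short_exact S G0 (\<lambda>x. l \<odot>\<^bsub>G0\<^esub> x) G0 p0 F0"
    and ex1: "short_exact S G1 (\<lambda>x. l \<odot>\<^bsub>G1\<^esub> x) G1 p1 F1"
    and sq1: "\<And>x. x \<in> carrier G1 \<Longrightarrow> p0 (g1 x) = f1 (p1 x)"
  shows "module (S Quot (PIdl\<^bsub>S\<^esub> l)) (coker (as_Quot_module F1) f1 (as_Quot_module F0))"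
    and "module_isomorphic (S Quot (PIdl\<^bsub>S\<^esub> l)) (quot_by_elem l (coker G1 g1 G0))
      (coker (as_Quot_module F1) f1 (as_Quot_module F0))"
proof -
  interpret S: cring S by fact
  interpret G0: module S G0 by fact
  interpret F0: module S F0 by fact
  interpret F1: module S F1 by fact
  let ?I = "PIdl\<^bsub>S\<^esub> l" and ?D = "f1 ` carrier F1" and ?N = "coker G1 g1 G0"
  let ?L = "(\<lambda>x. l \<odot>\<^bsub>?N\<^esub> x) ` carrier ?N"
  have I: "ideal ?I S" by (rule S.cgenideal_ideal[OF S(2)])
  have D: "submodule ?D S F0" by (rule submodule_image[OF mods(4,3) f1])
  interpret N: module S ?N
    unfolding coker_def by (rule G0.module_quot_module[OF submodule_image[OF mods(2,1) g1]])
  have L: "submodule ?L S ?N"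
    by (rule submodule_image[OF N.module_axioms N.module_axioms N.smult_in_module_homs[OF S(2)]])
  interpret NL: module S "quot_module ?N ?L" by (rule N.module_quot_module[OF L])
  interpret C: module S "coker F1 f1 F0"
    unfolding coker_def by (rule F0.module_quot_module[OF D])
  have annF0: "b \<odot>\<^bsub>F0\<^esub> x = \<zero>\<^bsub>F0\<^esub>" if "b \<in> ?I" "x \<in> carrier F0" for b x
    by (rule F0.PIdl_annihilates[OF S(2) short_exact_smult_annihilates[OF mods(1) ex0 S(2)] that])
  have annF1: "b \<odot>\<^bsub>F1\<^esub> x = \<zero>\<^bsub>F1\<^esub>" if "b \<in> ?I" "x \<in> carrier F1" for b x
    by (rule F1.PIdl_annihilates[OF S(2) short_exact_smult_annihilates[OF mods(2) ex1 S(2)] that])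
  have annNL: "b \<odot>\<^bsub>quot_module ?N ?L\<^esub> X = \<zero>\<^bsub>quot_module ?N ?L\<^esub>"
    if "b \<in> ?I" "X \<in> carrier (quot_module ?N ?L)" for b X
    by (rule NL.PIdl_annihilates[OF S(2) N.quot_module_annihilated[OF L S(2) imageI] that])
  have annC: "b \<odot>\<^bsub>coker F1 f1 F0\<^esub> X = \<zero>\<^bsub>coker F1 f1 F0\<^esub>"
    if bI: "b \<in> ?I" and X: "X \<in> carrier (coker F1 f1 F0)" for b X
    unfolding coker_def
  proof (rule F0.quot_module_annihilated[OF D])
    show "b \<odot>\<^bsub>F0\<^esub> x \<in> ?D" if "x \<in> carrier F0" for x
      using annF0[OF bI that] subgroup.one_closed[OF submodule.axioms(1)[OF D]] by simp
  qed (use ideal.Icarr[OF I bI] X in \<open>simp_all only: coker_def\<close>)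
  have f1R: "f1 \<in> module_homs (S Quot ?I) (as_Quot_module F1) (as_Quot_module F0)"
    by (rule module_homs_as_Quot_module[OF mods(4,3) I annF1 annF0 f1])
  interpret F0R: module "S Quot ?I" "as_Quot_module F0"
    by (rule F0.module_as_Quot_module[OF I annF0])
  have DR: "submodule ?D (S Quot ?I) (as_Quot_module F0)"
    using submodule_image[OF F1.module_as_Quot_module[OF I annF1] F0R.module_axioms f1R]
    unfolding as_Quot_module_simps .
  have coker_eq: "coker (as_Quot_module F1) f1 (as_Quot_module F0)
      = quot_module (as_Quot_module F0) ?D"
    unfolding coker_def as_Quot_module_simps ..
  show "module (S Quot ?I) (coker (as_Quot_module F1) f1 (as_Quot_module F0))"
    unfolding coker_eq by (rule F0R.module_quot_module[OF DR])
  have p1: "p1 ` carrier G1 = carrier F1"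
    using ex1 unfolding short_exact_def by blast
  have isoS: "module_isomorphic S (quot_module ?N ?L) (coker F1 f1 F0)"
    by (rule coker_mod_elem_isomorphic[OF S(2) mods g1 f1 ex0 p1 sq1])
  have iso: "module_isomorphic (S Quot ?I) (quot_by_elem l ?N) (as_Quot_module (coker F1 f1 F0))"
    unfolding quot_by_elem_def
    by (rule module_isomorphic_as_Quot_module[OF NL.module_axioms C.module_axioms I annNL annC isoS])
  show "module_isomorphic (S Quot ?I) (quot_by_elem l ?N)
      (coker (as_Quot_module F1) f1 (as_Quot_module F0))"
    unfolding coker_eq
  proof (rule module_isomorphic_cong[OF _ _ _ iso])
    show "A \<odot>\<^bsub>as_Quot_module (coker F1 f1 F0)\<^esub> X = A \<odot>\<^bsub>quot_module (as_Quot_module F0) ?D\<^esub> X"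
      if "A \<in> carrier (S Quot ?I)" "X \<in> carrier (quot_module (as_Quot_module F0) ?D)" for A X
      unfolding coker_def
      by (rule F0.smult_quot_module_as_Quot_module[OF I annF0 D DR])
        (use that in \<open>simp_all only: quot_module_as_Quot_module_simps\<close>)
  qed (simp_all only: coker_def as_Quot_module_simps quot_module_as_Quot_module_simps)
qed

theorem lemma3p2:
  fixes S :: "('s, 'm) ring_scheme" and l :: 's
    and G0 :: "('s, 'g0, 'n0) module_scheme" and G1 :: "('s, 'g1, 'n1) module_scheme"
    and G2 :: "('s, 'g2, 'n2) module_scheme"
    and F0 :: "('s, 'f0, 'k0) module_scheme" and F1 :: "('s, 'f1, 'k1) module_scheme"
    and F2 :: "('s, 'f2, 'k2) module_scheme"
    and g2 :: "'g2 \<Rightarrow> 'g1" and g1 :: "'g1 \<Rightarrow> 'g0"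
    and f2 :: "'f2 \<Rightarrow> 'f1" and f1 :: "'f1 \<Rightarrow> 'f0"
    and p0 :: "'g0 \<Rightarrow> 'f0" and p1 :: "'g1 \<Rightarrow> 'f1" and p2 :: "'g2 \<Rightarrow> 'f2"
  assumes "cring S" and "regular_element S l"
    and "module S G0" "module S G1" "module S G2"
    and "module S F0" "module S F1" "module S F2"
    and "g2 \<in> module_homs S G2 G1" "g1 \<in> module_homs S G1 G0"
    and "f2 \<in> module_homs S F2 F1" "f1 \<in> module_homs S F1 F0"
    and "p0 \<in> module_homs S G0 F0" "p1 \<in> module_homs S G1 F1" "p2 \<in> module_homs S G2 F2"
    and "short_exact S G0 (\<lambda>x. l \<odot>\<^bsub>G0\<^esub> x) G0 p0 F0"
    and "short_exact S G1 (\<lambda>x. l \<odot>\<^bsub>G1\<^esub> x) G1 p1 F1"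
    and "short_exact S G2 (\<lambda>x. l \<odot>\<^bsub>G2\<^esub> x) G2 p2 F2"
    and "\<forall>x\<in>carrier G2. p1 (g2 x) = f2 (p2 x)"
    and "\<forall>x\<in>carrier G1. p0 (g1 x) = f1 (p1 x)"
    and "exact_at S F2 f2 F1 f1 F0"
  shows "is_lifting S l (coker G1 g1 G0) (coker (as_Quot_module F1) f1 (as_Quot_module F0)) \<longleftrightarrow>
    (g1 \<circ> g2) ` carrier G2 \<subseteq> (\<lambda>x. l \<odot>\<^bsub>G0\<^esub> x) ` (g1 ` carrier G1)"
proof -
  have l: "l \<in> carrier S" using assms(2) by (simp add: regular_element_def)
  interpret G0: module S G0 by fact
  have sq2: "\<And>x. x \<in> carrier G2 \<Longrightarrow> p1 (g2 x) = f2 (p2 x)"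
    and sq1: "\<And>x. x \<in> carrier G1 \<Longrightarrow> p0 (g1 x) = f1 (p1 x)"
    using assms(19,20) by blast+
  have p2: "p2 ` carrier G2 = carrier F2"
    using assms(18) by (simp add: short_exact_def)
  have "module S (coker G1 g1 G0)"
    unfolding coker_def by (rule G0.module_quot_module[OF submodule_image]) fact+
  moreover note quot_by_elem_coker_isomorphic[OF assms(1) l assms(3,4,6,7,10,12,16,17) sq1]
  moreover have "regular_on l (coker G1 g1 G0) \<longleftrightarrow>
      (g1 \<circ> g2) ` carrier G2 \<subseteq> (\<lambda>x. l \<odot>\<^bsub>G0\<^esub> x) ` (g1 ` carrier G1)"
    by (rule regular_on_coker_iff[OF l assms(3,4,6,7,9,10,12,16,17) p2 sq2 sq1 assms(21)])
  ultimately show ?thesis unfolding is_lifting_def by blast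
qed

end
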